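(* Let $\alpha\ge1$ be a rational number and let $f$ be a completely additive function satisfying $f(x)>c\sqrt{\log(x)}$ for all integers $x\ge2$ and some constant $c>0$. Then $$\sum_{k\ge2}\frac{(-1)^k}{k f(\alpha k)}+f(2)\sum_{k\ge2}\frac{1}{k f(\alpha k)f(2\alpha k)}=\frac{1}{f(2\alpha)}.$$
   Context: A (real-valued) function $f$ defined on the positive integers is called completely additive if $f(mn)=f(m)+f(n)$ for all positive integers $m,n$. Such a function is extended to the positive rational numbers by $f(m/n)=f(m)-f(n)$ for positive integers $m,n$; the values $f(\alpha k)$, $f(2\alpha k)$ and $f(2\alpha)$ are those of this extension. Here $\log$ is the natural logarithm, and the sums run over integers $k\ge2$.
   Formalization: Since f(αk) may vanish and either series may diverge (α=1, f(p)=√log p), it is assumed that f(αk)≠0 for k≥2; the joint partial sums are shown to tend to 1/f(2α), and the identity of the two separate sums is proved whenever either series converges. *)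

theory Defs
  imports Complex_Main
begin

definition completely_additive :: "(nat \<Rightarrow> real) \<Rightarrow> bool" where
  "completely_additive f \<longleftrightarrow> (\<forall>m n. m > 0 \<longrightarrow> n > 0 \<longrightarrow> f (m * n) = f m + f n)"

(* Meaningful only for positive arguments; see rat_ext_divide for independence of the
   chosen fraction. *)
definition rat_ext :: "(nat \<Rightarrow> real) \<Rightarrow> rat \<Rightarrow> real" where
  "rat_ext f r = f (nat (fst (quotient_of r))) - f (nat (snd (quotient_of r)))"

lemma rat_ext_divide:
  assumes f: "completely_additive f" and m: "m > 0" and n: "n > 0"
  shows "rat_ext f (of_nat m / of_nat n) = f m - f n"
proof -
  obtain a b where ab: "quotient_of (of_nat m / of_nat n) = (a, b)" by (rule prod.exhaust)
  have b: "b > 0" using quotient_of_denom_pos[OF ab] .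
  have eq: "(of_nat m :: rat) / of_nat n = of_int a / of_int b"
    using quotient_of_div[OF ab] .
  have "(of_int a :: rat) / of_int b > 0"
    using m n by (subst eq[symmetric]) simp
  then have a: "a > 0" using b by (simp add: zero_less_divide_iff)
  have "(of_nat m :: rat) * of_int b = of_int a * of_nat n"
    using eq b n by (simp add: frac_eq_eq)
  then have "(of_int (int m * b) :: rat) = of_int (a * int n)" by simp
  then have "int m * b = a * int n" by (simp only: of_int_eq_iff)
  then have "int (m * nat b) = int (nat a * n)"
    using a b by simp
  then have "m * nat b = nat a * n" by (simp only: of_nat_eq_iff)
  moreover have "f (m * nat b) = f m + f (nat b)"
    using f m b unfolding completely_additive_def by simp
  moreover have "f (nat a * n) = f (nat a) + f n"
    using f n a unfolding completely_additive_def by simp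
  ultimately have "f m + f (nat b) = f (nat a) + f n" by (simp only:)
  then have "f m - f n = f (nat a) - f (nat b)" by linarith
  then show ?thesis unfolding rat_ext_def ab by (simp only: fst_conv snd_conv)
qed

lemma rat_ext_of_nat:
  assumes "completely_additive f" "m > 0"
  shows "rat_ext f (of_nat m) = f m"
proof -
  have "f (1 * 1) = f 1 + f 1"
    using assms(1) unfolding completely_additive_def by (metis zero_less_one)
  then have "f 1 = 0" unfolding mult_1 by linarith
  moreover have "rat_ext f (of_nat m / of_nat 1) = f m - f 1"
    using rat_ext_divide[OF assms zero_less_one] .
  ultimately show ?thesis unfolding of_nat_1 div_by_1 by linarith
qed

end

theory Submission
  imports Defs
begin

text \<open>
  Put \<open>g k = f (\<alpha> k)\<close>. Additivity gives \<open>g (2 k) = g k + f 2\<close>, so partial fractions turn the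
  second summand into \<open>u k - h k\<close> with \<open>u k = 1 / (k g k)\<close> and \<open>h k = 1 / (k g (2 k))\<close>, while the
  first one is \<open>(-1) ^ k u k\<close>. Adding them cancels \<open>u k\<close> for odd \<open>k\<close> and doubles it for even
  \<open>k = 2 j\<close>, where \<open>2 u (2 j) = h j\<close>. Hence the \<open>N\<close>-th partial sum is
  \<open>(\<Sum>j=1..N div 2. h j) - (\<Sum>k=2..N. h k)\<close>: only \<open>h 1 = 1 / f (2 \<alpha>)\<close> and the block
  \<open>N/2 < k \<le> N\<close> survive (\<open>sum_alternating_plus_difference\<close>). On that block the reciprocals
  of \<open>k\<close> have bounded sum, and the growth hypothesis sends \<open>g\<close> to infinity, so the block
  vanishes in the limit (\<open>dyadic_block_sum_tendsto_0\<close>).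

  The limit of the combined partial sums and \<open>f 2 \<noteq> 0\<close> make each of the two series converge as soon
  as the other one does.
\<close>

text \<open>
  In passing from \<open>N\<close> to \<open>N + 1\<close> the new term \<open>h (N + 1)\<close> enters the block on the right. When
  \<open>N + 1 = 2 j\<close> is even, \<open>h j\<close> leaves it, which is accounted for by the doubled term \<open>2 u (2 j)\<close>
  on the left.
\<close>
lemma sum_alternating_plus_difference:
  fixes u h :: "nat \<Rightarrow> real"
  assumes double: "\<And>j. j \<ge> 1 \<Longrightarrow> 2 * u (2 * j) = h j" and "N \<ge> 1"
  shows "(\<Sum>k=2..N. (-1) ^ k * u k) + (\<Sum>k=2..N. u k - h k) = h 1 - (\<Sum>k\<in>{N div 2<..N}. h k)"
  using \<open>N \<ge> 1\<close>
proof (induction N rule: dec_induct)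
  case base
  have "{1 div 2<..1::nat} = {1}" by auto
  then show ?case by simp
next
  case (step N)
  have split: "(\<Sum>k=2..Suc N. w k) = (\<Sum>k=2..N. w k) + w (Suc N)" for w :: "nat \<Rightarrow> real"
    using step.hyps by simp
  show ?case
  proof (cases "even (Suc N)")
    case True
    then obtain j where j: "Suc N = 2 * j" by (elim evenE)
    then have "j \<ge> 1" by simp
    have "N div 2 = j - 1" "Suc N div 2 = j" using j by presburger+
    then have "{N div 2<..N} = insert j {j<..N}" "{Suc N div 2<..Suc N} = insert (Suc N) {j<..N}"
      using j \<open>j \<ge> 1\<close> by auto
    then have "(\<Sum>k\<in>{Suc N div 2<..Suc N}. h k) = (\<Sum>k\<in>{N div 2<..N}. h k) - h j + h (Suc N)"
      by simp
    moreover have "2 * u (Suc N) = h j" using double[OF \<open>j \<ge> 1\<close>] j by simp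
    moreover have "(-1) ^ Suc N * u (Suc N) = u (Suc N)"
      using True by (simp only: power_minus_even power_one mult_1)
    ultimately show ?thesis unfolding split using step.IH by linarith
  next
    case False
    then have "Suc N div 2 = N div 2" by presburger
    then have "{Suc N div 2<..Suc N} = insert (Suc N) {N div 2<..N}" by auto
    then have "(\<Sum>k\<in>{Suc N div 2<..Suc N}. h k) = (\<Sum>k\<in>{N div 2<..N}. h k) + h (Suc N)"
      by simp
    moreover have "(-1) ^ Suc N * u (Suc N) = - u (Suc N)"
      using power_minus_odd[OF False, of "1::real"] by simp
    ultimately show ?thesis unfolding split using step.IH by linarith
  qed
qed

text \<open>
  The block has at most \<open>N\<close> indices, each larger than \<open>N/2\<close>, so a bound \<open>e / k\<close> on the
  terms bounds the whole sum by \<open>2 e\<close>.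
\<close>
lemma dyadic_block_sum_tendsto_0:
  fixes h :: "nat \<Rightarrow> real"
  assumes "(\<lambda>k. real k * h k) \<longlonglongrightarrow> 0"
  shows "(\<lambda>N. \<Sum>k\<in>{N div 2<..N}. h k) \<longlonglongrightarrow> 0"
proof (rule LIMSEQ_I)
  fix r :: real assume "r > 0"
  then obtain K where K: "\<And>k. k \<ge> K \<Longrightarrow> \<bar>real k * h k\<bar> < r / 3"
    using LIMSEQ_D[OF assms, of "r / 3"] by auto
  have "norm ((\<Sum>k\<in>{N div 2<..N}. h k) - 0) < r" if "N \<ge> 2 * K + 1" for N
  proof -
    have "\<bar>h k\<bar> \<le> 2 * (r / 3) / real N" if "k \<in> {N div 2<..N}" for k
    proof -
      have k: "k \<ge> K" "N \<le> 2 * k" "k > 0" using that \<open>N \<ge> 2 * K + 1\<close> by auto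
      have "real N * \<bar>h k\<bar> \<le> real (2 * k) * \<bar>h k\<bar>"
        using k(2) by (intro mult_right_mono) auto
      also have "\<dots> = 2 * \<bar>real k * h k\<bar>" by (simp add: abs_mult)
      also have "\<dots> \<le> 2 * (r / 3)" using K[OF k(1)] by simp
      finally show ?thesis using \<open>N \<ge> 2 * K + 1\<close> by (simp add: field_simps)
    qed
    then have "(\<Sum>k\<in>{N div 2<..N}. \<bar>h k\<bar>) \<le> real (card {N div 2<..N}) * (2 * (r / 3) / real N)"
      by (rule sum_bounded_above)
    also have "\<dots> \<le> real N * (2 * (r / 3) / real N)"
      using \<open>r > 0\<close> by (intro mult_right_mono) auto
    also have "\<dots> = 2 * (r / 3)" using \<open>N \<ge> 2 * K + 1\<close> by simp
    also have "\<dots> < r" using \<open>r > 0\<close> by simp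
    finally have "(\<Sum>k\<in>{N div 2<..N}. \<bar>h k\<bar>) < r" .
    with sum_abs[of h "{N div 2<..N}"] have "\<bar>\<Sum>k\<in>{N div 2<..N}. h k\<bar> < r"
      by (rule order_le_less_trans)
    then show ?thesis by simp
  qed
  then show "\<exists>M. \<forall>N\<ge>M. norm ((\<Sum>k\<in>{N div 2<..N}. h k) - 0) < r" by blast
qed

lemma rat_ext_mult_of_nat:
  assumes f: "completely_additive f" and "\<alpha> > 0" and k: "k > 0"
  shows "rat_ext f (\<alpha> * of_nat k) = rat_ext f \<alpha> + f k"
proof -
  obtain a b where ab: "quotient_of \<alpha> = (a, b)" by (rule prod.exhaust)
  have b: "b > 0" using quotient_of_denom_pos[OF ab] .
  have "\<alpha> = of_int a / of_int b" using quotient_of_div[OF ab] .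
  moreover from this have a: "a > 0" using b \<open>\<alpha> > 0\<close> by (simp add: zero_less_divide_iff)
  ultimately have \<alpha>: "\<alpha> = of_nat (nat a) / of_nat (nat b)" using b by simp
  then have "\<alpha> * of_nat k = of_nat (nat a * k) / of_nat (nat b)" by simp
  then have "rat_ext f (\<alpha> * of_nat k) = f (nat a * k) - f (nat b)"
    using rat_ext_divide[OF f, of "nat a * k" "nat b"] a b k by simp
  also have "f (nat a * k) = f (nat a) + f k"
    using f a k unfolding completely_additive_def by simp
  finally show ?thesis
    using rat_ext_divide[OF f, of "nat a" "nat b"] a b \<alpha> by simp
qed

text \<open>
  The combined series converges, so subtracting the convergent one of the two leaves the other, up
  to the invertible factor \<open>b\<close>.
\<close>
lemma summable_either_imp_both:
  fixes A B :: "nat \<Rightarrow> real"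
  assumes lim: "(\<lambda>N. (\<Sum>k=m..N. A k) + b * (\<Sum>k=m..N. B k)) \<longlonglongrightarrow> L" and "b \<noteq> 0"
    and either: "summable (\<lambda>k. A (k + m)) \<or> summable (\<lambda>k. B (k + m))"
  shows "summable (\<lambda>k. A (k + m)) \<and> summable (\<lambda>k. B (k + m)) \<and>
         (\<Sum>k. A (k + m)) + b * (\<Sum>k. B (k + m)) = L"
proof -
  have shift: "(\<Sum>k<Suc n. w (k + m)) = (\<Sum>k=m..n + m. w k)" for w :: "nat \<Rightarrow> real" and n
    using sum.shift_bounds_cl_nat_ivl[of w 0 m n] by (simp add: atLeast0AtMost lessThan_Suc_atMost)
  have "(\<lambda>n. (\<Sum>k<Suc n. A (k + m)) + b * (\<Sum>k<Suc n. B (k + m))) \<longlonglongrightarrow> L"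
    unfolding shift using LIMSEQ_ignore_initial_segment[OF lim, of m] .
  then have "(\<lambda>n. (\<Sum>k<n. A (k + m)) + b * (\<Sum>k<n. B (k + m))) \<longlonglongrightarrow> L"
    by (rule LIMSEQ_imp_Suc)
  then have comb: "(\<lambda>k. A (k + m) + b * B (k + m)) sums L"
    unfolding sums_def by (simp add: sum.distrib sum_distrib_left)
  have both: "summable (\<lambda>k. A (k + m))" "summable (\<lambda>k. B (k + m))"
  proof -
    have A: "summable (\<lambda>k. A (k + m))" if "summable (\<lambda>k. B (k + m))"
      using summable_diff[OF sums_summable[OF comb] summable_mult[OF that, of b]] by simp
    have B: "summable (\<lambda>k. B (k + m))" if "summable (\<lambda>k. A (k + m))"
      using summable_mult[OF summable_diff[OF sums_summable[OF comb] that], of "1 / b"] \<open>b \<noteq> 0\<close>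
      by simp
    show "summable (\<lambda>k. A (k + m))" "summable (\<lambda>k. B (k + m))" using A B either by blast+
  qed
  have "(\<lambda>k. A (k + m) + b * B (k + m)) sums ((\<Sum>k. A (k + m)) + b * (\<Sum>k. B (k + m)))"
    by (intro sums_add sums_mult summable_sums both)
  then show ?thesis using both sums_unique2[OF comb] by simp
qed

theorem mainTheorem4:
  fixes f :: "nat \<Rightarrow> real" and \<alpha> :: rat and c :: real
  assumes "\<alpha> \<ge> 1"
    and "completely_additive f"
    and "c > 0"
    and "\<And>x::nat. x \<ge> 2 \<Longrightarrow> f x > c * sqrt (ln (real x))"
    and "\<And>k::nat. k \<ge> 2 \<Longrightarrow> rat_ext f (\<alpha> * of_nat k) \<noteq> 0"
  shows "let A = (\<lambda>k::nat. (-1) ^ k / (real k * rat_ext f (\<alpha> * of_nat k)));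
             B = (\<lambda>k::nat. 1 / (real k * rat_ext f (\<alpha> * of_nat k) * rat_ext f (2 * \<alpha> * of_nat k)))
         in (\<lambda>N. (\<Sum>k=2..N. A k) + f 2 * (\<Sum>k=2..N. B k)) \<longlonglongrightarrow> 1 / rat_ext f (2 * \<alpha>)
          \<and> (summable (\<lambda>k. A (k + 2)) \<or> summable (\<lambda>k. B (k + 2)) \<longrightarrow>
               summable (\<lambda>k. A (k + 2)) \<and> summable (\<lambda>k. B (k + 2)) \<and>
               (\<Sum>k. A (k + 2)) + f 2 * (\<Sum>k. B (k + 2)) = 1 / rat_ext f (2 * \<alpha>))"
proof -
  define g where "g k = rat_ext f (\<alpha> * of_nat k)" for k :: nat
  define u where "u k = 1 / (real k * g k)" for k
  define h where "h k = 1 / (real k * g (2 * k))" for k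
  define A where "A = (\<lambda>k::nat. (-1) ^ k / (real k * rat_ext f (\<alpha> * of_nat k)))"
  define B where "B = (\<lambda>k::nat. 1 / (real k * rat_ext f (\<alpha> * of_nat k)
                                   * rat_ext f (2 * \<alpha> * of_nat k)))"
  have "\<alpha> > 0" using assms(1) by simp
  have g: "g k = rat_ext f \<alpha> + f k" if "k > 0" for k
    unfolding g_def by (rule rat_ext_mult_of_nat[OF assms(2) \<open>\<alpha> > 0\<close> that])
  have g_double: "g (2 * k) = g k + f 2" if "k > 0" for k
    using g that assms(2) unfolding completely_additive_def by simp
  have g_nz: "g k \<noteq> 0" if "k \<ge> 2" for k
    unfolding g_def by (rule assms(5)[OF that])
  have "f 2 > 0"
  proof -
    have "0 \<le> c * sqrt (ln (real 2))" using \<open>c > 0\<close> by simp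
    also have "\<dots> < f 2" by (rule assms(4)) simp
    finally show ?thesis .
  qed

  have A: "A k = (-1) ^ k * u k" for k
    unfolding A_def u_def g_def by simp
  have B: "f 2 * B k = u k - h k" if "k \<ge> 2" for k
  proof -
    have "2 * \<alpha> * of_nat k = \<alpha> * of_nat (2 * k)" by simp
    then have "f 2 * B k = f 2 / (real k * g k * g (2 * k))"
      unfolding B_def g_def by (simp only: times_divide_eq_right mult_1_right)
    also have "\<dots> = (g (2 * k) - g k) / (real k * g k * g (2 * k))"
      using g_double[of k] that by simp
    also have "\<dots> = u k - h k"
      using g_nz[of k] g_nz[of "2 * k"] that unfolding u_def h_def by (simp add: field_simps)
    finally show ?thesis .
  qed
  have "2 * u (2 * j) = h j" for j
    unfolding u_def h_def by simp
  note partial = sum_alternating_plus_difference[of u h, OF this]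

  have "filterlim f at_top sequentially"
  proof (rule filterlim_at_top_mono)
    show "filterlim (\<lambda>x. c * sqrt (ln (real x))) at_top sequentially"
      by (intro filterlim_tendsto_pos_mult_at_top[OF tendsto_const \<open>c > 0\<close>]
          filterlim_compose[OF sqrt_at_top] filterlim_compose[OF ln_at_top]
          filterlim_real_sequentially)
    show "eventually (\<lambda>x. c * sqrt (ln (real x)) \<le> f x) sequentially"
      using eventually_ge_at_top[of 2] by eventually_elim (use assms(4) in force)
  qed
  then have "filterlim (\<lambda>k. rat_ext f \<alpha> + f k) at_top sequentially"
    by (rule filterlim_tendsto_add_at_top[OF tendsto_const])
  then have "filterlim (\<lambda>k. rat_ext f \<alpha> + f (2 * k)) at_top sequentially"
    by (rule filterlim_compose) (simp add: filterlim_subseq strict_mono_def)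
  then have "(\<lambda>k. inverse (rat_ext f \<alpha> + f (2 * k))) \<longlonglongrightarrow> 0"
    by (rule tendsto_inverse_0_at_top)
  then have "(\<lambda>k. real k * h k) \<longlonglongrightarrow> 0"
  proof (rule Lim_transform_eventually)
    show "eventually (\<lambda>k. inverse (rat_ext f \<alpha> + f (2 * k)) = real k * h k) sequentially"
      using eventually_gt_at_top[of 0]
      by eventually_elim (simp add: h_def g divide_inverse)
  qed
  then have "(\<lambda>N. h 1 - (\<Sum>k\<in>{N div 2<..N}. h k)) \<longlonglongrightarrow> h 1 - 0"
    by (intro tendsto_diff tendsto_const dyadic_block_sum_tendsto_0)
  moreover have "eventually (\<lambda>N. h 1 - (\<Sum>k\<in>{N div 2<..N}. h k)
      = (\<Sum>k=2..N. A k) + f 2 * (\<Sum>k=2..N. B k)) sequentially"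
    using eventually_ge_at_top[of 1]
  proof eventually_elim
    case (elim N)
    have "f 2 * (\<Sum>k=2..N. B k) = (\<Sum>k=2..N. u k - h k)"
      unfolding sum_distrib_left by (intro sum.cong) (auto simp: B)
    then show ?case using partial[OF elim] by (simp add: A)
  qed
  ultimately have "(\<lambda>N. (\<Sum>k=2..N. A k) + f 2 * (\<Sum>k=2..N. B k)) \<longlonglongrightarrow> h 1 - 0"
    by (rule Lim_transform_eventually)
  moreover have "h 1 - 0 = 1 / rat_ext f (2 * \<alpha>)"
    unfolding h_def g_def by (simp add: mult.commute)
  ultimately have lim: "(\<lambda>N. (\<Sum>k=2..N. A k) + f 2 * (\<Sum>k=2..N. B k))
      \<longlonglongrightarrow> 1 / rat_ext f (2 * \<alpha>)"
    by (simp only:)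
  moreover have "f 2 \<noteq> 0" using \<open>f 2 > 0\<close> by simp
  ultimately show ?thesis
    unfolding Let_def A_def[symmetric] B_def[symmetric]
    using summable_either_imp_both[OF lim] by blast
qed

end
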